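(* Let $L$ be a free $\mathbb{Z}$-module of finite rank $n$, and let $A\subseteq L$ be a periodic subset. Then: (1) For every norm $N$ on $V=L\otimes_{\mathbb{Z}}\mathbb{R}$, every period $\varpi$ of $A$, and every basis $\mathcal{B}$ of $L$, the limit defining $\mathfrak{d}_N(A\mid L)$ exists and $$\mathfrak{d}_N(A\mid L)=\frac{|\mathcal{F}_{\mathcal{B}}\cap A|}{|\mathcal{F}_{\mathcal{B}}|}.$$ In particular this quantity is independent of the choices of $N$, $\varpi$ and $\mathcal{B}$; denote it by $\mathfrak{d}(A\mid L)$. (2) If $A$ is a sublattice of $L$, then $\mathfrak{d}(A\mid L)=\dfrac{1}{[L:A]}$. (3) If $x\in L$, then $\mathfrak{d}(A+x\mid L)=\mathfrak{d}(A\mid L)$.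
   Context: For a norm $N$ on $V$, $$\mathfrak{d}_N(A\mid L)=\lim_{r\to\infty}\frac{\#\{a\in A : N(a)<r\}}{\#\{v\in L : N(v)<r\}},$$ provided the limit exists. A positive integer $\varpi$ is a period of $A$ when $A+\varpi L=A$; $A$ is periodic when it has a period. Given a period $\varpi$ of $A$ and a basis $\mathcal{B}=\{v_1,\ldots,v_n\}$ of $L$, put $$\mathcal{F}_{\mathcal{B}}=\left\{\sum_{i=1}^n c_iv_i : c_i\in\mathbb{Z},\ 0\leq c_i<\varpi\right\}.$$ *)

theory Defs
  imports "HOL-Analysis.Analysis" "HOL-Library.Poly_Mapping"
begin

section \<open>Extension of scalars from the integers to the reals\<close>

text \<open>
  For an abelian group \<open>L\<close>, given as a type \<open>'l\<close>, the tensor product of \<open>L\<close> with the reals over the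
  integers is the free abelian group on \<open>L \<times> \<real>\<close> modulo the subgroup generated by the two families
  of biadditivity relations. The relation \<open>(k v) \<otimes> r = v \<otimes> (k r)\<close> for integers \<open>k\<close> follows from
  these (lemma \<open>tensor_balanced\<close> below), so it is not imposed separately.
\<close>

inductive_set tensor_relations :: "(('l::ab_group_add \<times> real) \<Rightarrow>\<^sub>0 int) set" where
  zero: "0 \<in> tensor_relations"
| diff: "x \<in> tensor_relations \<Longrightarrow> y \<in> tensor_relations \<Longrightarrow> x - y \<in> tensor_relations"
| left: "frag_of (v + w, r) - frag_of (v, r) - frag_of (w, r) \<in> tensor_relations"
| right: "frag_of (v, r + s) - frag_of (v, r) - frag_of (v, s) \<in> tensor_relations"

lemma tensor_relations_minus: "x \<in> tensor_relations \<Longrightarrow> - x \<in> tensor_relations"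
  using tensor_relations.diff[OF tensor_relations.zero] by fastforce

lemma tensor_relations_add:
  "x \<in> tensor_relations \<Longrightarrow> y \<in> tensor_relations \<Longrightarrow> x + y \<in> tensor_relations"
  using tensor_relations.diff[OF _ tensor_relations_minus] by fastforce

definition tensor_eq :: "(('l::ab_group_add \<times> real) \<Rightarrow>\<^sub>0 int) \<Rightarrow> (('l \<times> real) \<Rightarrow>\<^sub>0 int) \<Rightarrow> bool" where
  "tensor_eq x y \<longleftrightarrow> x - y \<in> tensor_relations"

quotient_type (overloaded) 'l real_tensor =
  "('l::ab_group_add \<times> real) \<Rightarrow>\<^sub>0 int" / tensor_eq
proof (rule equivpI)
  show "reflp tensor_eq"
    by (simp add: reflp_def tensor_eq_def tensor_relations.zero)
  show "symp tensor_eq"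
    using tensor_relations_minus by (fastforce simp: symp_def tensor_eq_def)
  show "transp tensor_eq"
    using tensor_relations_add by (fastforce simp: transp_def tensor_eq_def)
qed

lift_definition tensor :: "'l::ab_group_add \<Rightarrow> real \<Rightarrow> 'l real_tensor" (infixl "\<otimes>\<^sub>\<real>" 75)
  is "\<lambda>v r. frag_of (v, r)" .

definition scale_formal :: "real \<Rightarrow> (('l \<times> real) \<Rightarrow>\<^sub>0 int) \<Rightarrow> (('l \<times> real) \<Rightarrow>\<^sub>0 int)" where
  "scale_formal c = frag_extend (\<lambda>(v, r). frag_of (v, c * r))"

lemma scale_formal_of [simp]: "scale_formal c (frag_of (v, r)) = frag_of (v, c * r)"
  by (simp add: scale_formal_def)

lemma scale_formal_0 [simp]: "scale_formal c 0 = 0"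
  by (simp add: scale_formal_def)

lemma scale_formal_diff: "scale_formal c (x - y) = scale_formal c x - scale_formal c y"
  by (simp add: scale_formal_def frag_extend_diff)

lemma scale_formal_add: "scale_formal c (x + y) = scale_formal c x + scale_formal c y"
  by (simp add: scale_formal_def frag_extend_add)

lemma scale_formal_relations:
  assumes "x \<in> tensor_relations"
  shows "scale_formal c x \<in> tensor_relations"
  using assms
proof induction
  case (right v r s)
  show ?case
    using tensor_relations.right[of v "c * r" "c * s"] by (simp add: scale_formal_diff distrib_left)
qed (simp_all add: scale_formal_diff tensor_relations.zero tensor_relations.diff tensor_relations.left)

lemma formal_induct [case_names zero of diff]:
  assumes "P 0" "\<And>v r. P (frag_of (v, r))" "\<And>x y. P x \<Longrightarrow> P y \<Longrightarrow> P (x - y)"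
  shows "P (x :: ('l \<times> real) \<Rightarrow>\<^sub>0 int)"
  by (rule frag_induction[of x UNIV]) (use assms in auto)

lemma scale_formal_left_distrib:
  "tensor_eq (scale_formal (a + b) x) (scale_formal a x + scale_formal b x)"
proof (induction x rule: formal_induct)
  case zero
  then show ?case by (simp add: tensor_eq_def tensor_relations.zero)
next
  case (of v r)
  show ?case
    using tensor_relations.right[of v "a * r" "b * r"]
    by (simp add: tensor_eq_def distrib_right diff_diff_eq)
next
  case (diff x y)
  then have "(scale_formal (a + b) x - (scale_formal a x + scale_formal b x))
      - (scale_formal (a + b) y - (scale_formal a y + scale_formal b y)) \<in> tensor_relations"
    unfolding tensor_eq_def by (rule tensor_relations.diff)
  then show ?case
    by (simp add: tensor_eq_def scale_formal_diff algebra_simps)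
qed

lemma scale_formal_scale_formal: "scale_formal a (scale_formal b x) = scale_formal (a * b) x"
  by (induction x rule: formal_induct) (simp_all add: scale_formal_diff mult.assoc)

lemma scale_formal_one: "scale_formal 1 x = x"
  by (induction x rule: formal_induct) (simp_all add: scale_formal_diff)

text \<open>The scalar multiplication of the instance below is determined by
  \<open>c (v \<otimes> r) = v \<otimes> (c r)\<close> and additivity.\<close>

instantiation real_tensor :: (ab_group_add) real_vector
begin

lift_definition zero_real_tensor :: "'a real_tensor" is 0 .

lift_definition plus_real_tensor :: "'a real_tensor \<Rightarrow> 'a real_tensor \<Rightarrow> 'a real_tensor"
  is "(+)"
  unfolding tensor_eq_def by (metis add_diff_add tensor_relations_add)

lift_definition uminus_real_tensor :: "'a real_tensor \<Rightarrow> 'a real_tensor"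
  is uminus
  unfolding tensor_eq_def by (metis minus_diff_minus tensor_relations_minus)

lift_definition minus_real_tensor :: "'a real_tensor \<Rightarrow> 'a real_tensor \<Rightarrow> 'a real_tensor"
  is "(-)"
proof -
  fix x x' y y' :: "('a \<times> real) \<Rightarrow>\<^sub>0 int"
  assume "tensor_eq x x'" "tensor_eq y y'"
  then have "(x - x') - (y - y') \<in> tensor_relations"
    unfolding tensor_eq_def by (rule tensor_relations.diff)
  then show "tensor_eq (x - y) (x' - y')"
    by (simp add: tensor_eq_def algebra_simps)
qed

lift_definition scaleR_real_tensor :: "real \<Rightarrow> 'a real_tensor \<Rightarrow> 'a real_tensor"
  is scale_formal
  unfolding tensor_eq_def by (metis scale_formal_diff scale_formal_relations)

instance
proof
  fix a b :: real and x y z :: "'a real_tensor"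
  show "x + y + z = x + (y + z)"
    by transfer (simp add: tensor_eq_def add.assoc tensor_relations.zero)
  show "x + y = y + x"
    by transfer (simp add: tensor_eq_def add.commute tensor_relations.zero)
  show "0 + x = x"
    by transfer (simp add: tensor_eq_def tensor_relations.zero)
  show "- x + x = 0"
    by transfer (simp add: tensor_eq_def tensor_relations.zero)
  show "x - y = x + - y"
    by transfer (simp add: tensor_eq_def tensor_relations.zero)
  show "a *\<^sub>R (x + y) = a *\<^sub>R x + a *\<^sub>R y"
    by transfer (simp add: tensor_eq_def scale_formal_add tensor_relations.zero)
  show "(a + b) *\<^sub>R x = a *\<^sub>R x + b *\<^sub>R x"
    by transfer (rule scale_formal_left_distrib)
  show "a *\<^sub>R b *\<^sub>R x = (a * b) *\<^sub>R x"
    by transfer (simp add: tensor_eq_def scale_formal_scale_formal tensor_relations.zero)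
  show "1 *\<^sub>R x = x"
    by transfer (simp add: tensor_eq_def scale_formal_one tensor_relations.zero)
qed

end

lemma tensor_add_left: "(v + w) \<otimes>\<^sub>\<real> r = v \<otimes>\<^sub>\<real> r + w \<otimes>\<^sub>\<real> r"
  by transfer (use tensor_relations.left in \<open>simp add: tensor_eq_def diff_diff_eq\<close>)

lemma tensor_add_right: "v \<otimes>\<^sub>\<real> (r + s) = v \<otimes>\<^sub>\<real> r + v \<otimes>\<^sub>\<real> s"
  by transfer (use tensor_relations.right in \<open>simp add: tensor_eq_def diff_diff_eq\<close>)

lemma scaleR_tensor: "c *\<^sub>R (v \<otimes>\<^sub>\<real> r) = v \<otimes>\<^sub>\<real> (c * r)"
  by transfer (simp add: tensor_eq_def tensor_relations.zero)

lemma tensor_balanced: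
  assumes "module (zscale :: int \<Rightarrow> 'l::ab_group_add \<Rightarrow> 'l)"
  shows "zscale k v \<otimes>\<^sub>\<real> r = v \<otimes>\<^sub>\<real> (of_int k * r)"
proof -
  interpret module zscale by fact
  interpret T: Modules.additive "\<lambda>v::'l. v \<otimes>\<^sub>\<real> r"
    by standard (rule tensor_add_left)
  have *: "zscale (int m) v \<otimes>\<^sub>\<real> r = v \<otimes>\<^sub>\<real> (real m * r)" for m
  proof (induction m)
    case 0
    show ?case
      using T.zero scaleR_tensor[of 0 v 0] by simp
  next
    case (Suc m)
    then show ?case
      by (simp add: scale_left_distrib T.add distrib_right tensor_add_right)
  qed
  show ?thesis
  proof (cases "k \<ge> 0")
    case True
    then show ?thesis using *[of "nat k"] by simp
  next
    case False
    have "zscale k v = - zscale (int (nat (- k))) v"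
      using False by simp
    then have "zscale k v \<otimes>\<^sub>\<real> r = - (v \<otimes>\<^sub>\<real> (real (nat (- k)) * r))"
      using *[of "nat (- k)"] T.minus by simp
    also have "\<dots> = (- 1) *\<^sub>R (v \<otimes>\<^sub>\<real> (real (nat (- k)) * r))"
      by simp
    also have "\<dots> = v \<otimes>\<^sub>\<real> (of_int k * r)"
      unfolding scaleR_tensor using False by simp
    finally show ?thesis .
  qed
qed

lemma real_tensor_induct [case_names tensor diff]:
  assumes tensor: "\<And>v r. P (v \<otimes>\<^sub>\<real> r)" and diff: "\<And>x y. P x \<Longrightarrow> P y \<Longrightarrow> P (x - y)"
  shows "P x"
proof -
  have "P (abs_real_tensor y)" for y
  proof (induction y rule: formal_induct)
    case zero
    show ?case
      using diff[OF tensor tensor, of 0 0 0 0] by (simp add: zero_real_tensor_def)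
  next
    case (of v r)
    show ?case using tensor[of v r] by (simp add: tensor.abs_eq)
  next
    case (diff x y)
    then show ?case using assms(2) by (metis minus_real_tensor.abs_eq)
  qed
  then show ?thesis
    by (metis Quotient3_abs_rep Quotient3_real_tensor)
qed

definition formal_lift :: "('l \<Rightarrow> 'w::real_vector) \<Rightarrow> (('l \<times> real) \<Rightarrow>\<^sub>0 int) \<Rightarrow> 'w" where
  "formal_lift h x =
     (\<Sum>i \<in> Poly_Mapping.keys x. of_int (Poly_Mapping.lookup x i) *\<^sub>R snd i *\<^sub>R h (fst i))"

lemma formal_lift_superset:
  assumes "finite I" "Poly_Mapping.keys x \<subseteq> I"
  shows "formal_lift h x = (\<Sum>i \<in> I. of_int (Poly_Mapping.lookup x i) *\<^sub>R snd i *\<^sub>R h (fst i))"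
  unfolding formal_lift_def
  by (rule sum.mono_neutral_left) (use assms in \<open>auto simp: in_keys_iff\<close>)

lemma formal_lift_diff: "formal_lift h (x - y) = formal_lift h x - formal_lift h y"
proof -
  define I where "I = Poly_Mapping.keys x \<union> Poly_Mapping.keys y"
  have I: "finite I" "Poly_Mapping.keys x \<subseteq> I" "Poly_Mapping.keys y \<subseteq> I"
    "Poly_Mapping.keys (x - y) \<subseteq> I"
    by (auto simp: I_def in_keys_iff lookup_minus)
  show ?thesis
    by (simp add: formal_lift_superset[OF I(1,2)] formal_lift_superset[OF I(1,3)]
        formal_lift_superset[OF I(1,4)] lookup_minus scaleR_left_diff_distrib left_diff_distrib sum_subtractf)
qed

lemma formal_lift_of [simp]: "formal_lift h (frag_of (v, r)) = r *\<^sub>R h v"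
  by (simp add: formal_lift_def)

lemma formal_lift_relations:
  assumes "Modules.additive h" "x \<in> tensor_relations"
  shows "formal_lift h x = 0"
  using assms(2)
proof induction
  case zero
  show ?case by (simp add: formal_lift_def)
next
  case (diff x y)
  then show ?case by (simp add: formal_lift_diff)
next
  case (left v w r)
  show ?case
    by (simp only: formal_lift_diff formal_lift_of Modules.additive.add[OF assms(1)] scaleR_right_distrib)
      simp
next
  case (right v r s)
  show ?case
    by (simp only: formal_lift_diff formal_lift_of scaleR_left_distrib) simp
qed

text \<open>The universal property of the extension of scalars.\<close>

lemma real_tensor_universal:
  fixes h :: "'l::ab_group_add \<Rightarrow> 'w::real_vector"
  assumes "Modules.additive h"
  shows "\<exists>!g. linear g \<and> (\<forall>v. g (v \<otimes>\<^sub>\<real> 1) = h v)"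
proof (rule ex_ex1I)
  define g where "g x = formal_lift h (rep_real_tensor x)" for x
  have g_abs: "g (abs_real_tensor y) = formal_lift h y" for y
  proof -
    have "tensor_eq (rep_real_tensor (abs_real_tensor y)) y"
      using Quotient3_real_tensor real_tensor_equivp
      by (metis Quotient3_def equivp_reflp rep_abs_rsp_left)
    then show ?thesis
      using formal_lift_relations[OF assms] formal_lift_diff
      unfolding g_def tensor_eq_def by (metis eq_iff_diff_eq_0)
  qed
  have g_tensor: "g (v \<otimes>\<^sub>\<real> r) = r *\<^sub>R h v" for v r
    by (simp add: tensor.abs_eq g_abs)
  have g_diff: "g (x - y) = g x - g y" for x y
    by (metis g_abs formal_lift_diff minus_real_tensor.abs_eq Quotient3_abs_rep Quotient3_real_tensor)
  have g_scale: "g (c *\<^sub>R x) = c *\<^sub>R g x" for c x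
    by (induction x rule: real_tensor_induct)
      (simp_all add: g_tensor g_diff scaleR_tensor scaleR_right_diff_distrib)
  have "g (x + y) = g x + g y" for x y
    using g_diff[of x "- y"] g_diff[of 0 y] g_scale[of 0 0] by simp
  then have "linear g"
    using g_scale by (rule linearI)
  then show "\<exists>g. linear g \<and> (\<forall>v. g (v \<otimes>\<^sub>\<real> 1) = h v)"
    using g_tensor by (intro exI[of _ g]) simp
next
  fix f g :: "'l real_tensor \<Rightarrow> 'w"
  assume f: "linear f \<and> (\<forall>v. f (v \<otimes>\<^sub>\<real> 1) = h v)" and g: "linear g \<and> (\<forall>v. g (v \<otimes>\<^sub>\<real> 1) = h v)"
  have "f x = g x" for x
  proof (induction x rule: real_tensor_induct)
    case (tensor v r)
    show ?case
      using f g linear_scale[of f r "v \<otimes>\<^sub>\<real> 1"] linear_scale[of g r "v \<otimes>\<^sub>\<real> 1"]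
      by (simp add: scaleR_tensor)
  next
    case (diff x y)
    then show ?case using f g by (simp add: linear_diff)
  qed
  then show "f = g" by blast
qed


section \<open>Density of periodic subsets\<close>

definition is_norm :: "('v::real_vector \<Rightarrow> real) \<Rightarrow> bool" where
  "is_norm N \<longleftrightarrow>
     (\<forall>x. 0 \<le> N x) \<and> (\<forall>x. N x = 0 \<longleftrightarrow> x = 0) \<and>
     (\<forall>c x. N (c *\<^sub>R x) = \<bar>c\<bar> * N x) \<and> (\<forall>x y. N (x + y) \<le> N x + N y)"

text \<open>Throughout, \<open>L\<close> is the whole type \<open>'l\<close>, with integer scalar multiplication \<open>zscale\<close>, and is
  mapped to the real vector space \<open>'l real_tensor\<close> by \<open>v \<mapsto> v \<otimes> 1\<close>.\<close>

definition is_basis :: "(int \<Rightarrow> 'l::ab_group_add \<Rightarrow> 'l) \<Rightarrow> 'l set \<Rightarrow> bool" where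
  "is_basis zscale B \<longleftrightarrow> \<not> module.dependent zscale B \<and> module.span zscale B = UNIV"

definition is_free_of_rank :: "(int \<Rightarrow> 'l::ab_group_add \<Rightarrow> 'l) \<Rightarrow> nat \<Rightarrow> bool" where
  "is_free_of_rank zscale n \<longleftrightarrow>
     module zscale \<and> (\<exists>B. is_basis zscale B \<and> finite B \<and> card B = n)"

definition is_period :: "(int \<Rightarrow> 'l::ab_group_add \<Rightarrow> 'l) \<Rightarrow> 'l set \<Rightarrow> int \<Rightarrow> bool" where
  "is_period zscale A p \<longleftrightarrow> 0 < p \<and> {a + zscale p v | a v. a \<in> A} = A"

definition is_periodic :: "(int \<Rightarrow> 'l::ab_group_add \<Rightarrow> 'l) \<Rightarrow> 'l set \<Rightarrow> bool" where
  "is_periodic zscale A \<longleftrightarrow> (\<exists>p. is_period zscale A p)"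

definition fundamental_box :: "(int \<Rightarrow> 'l::ab_group_add \<Rightarrow> 'l) \<Rightarrow> 'l set \<Rightarrow> int \<Rightarrow> 'l set" where
  "fundamental_box zscale B p = {\<Sum>v\<in>B. zscale (c v) v | c. \<forall>v\<in>B. 0 \<le> c v \<and> c v < p}"

text \<open>In the situation of interest (\<open>L\<close> free of finite rank, \<open>N\<close> a norm) both sets below are
  finite, so that \<open>card\<close> is the true number of elements.\<close>

definition density_quotient ::
  "('l::ab_group_add real_tensor \<Rightarrow> real) \<Rightarrow> 'l set \<Rightarrow> real \<Rightarrow> real" where
  "density_quotient N A r =
     real (card {a \<in> A. N (a \<otimes>\<^sub>\<real> 1) < r}) / real (card {v. N (v \<otimes>\<^sub>\<real> 1) < r})"

definition density_exists :: "('l::ab_group_add real_tensor \<Rightarrow> real) \<Rightarrow> 'l set \<Rightarrow> bool" where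
  "density_exists N A \<longleftrightarrow> (\<exists>d. (density_quotient N A \<longlongrightarrow> d) at_top)"

definition density_wrt :: "('l::ab_group_add real_tensor \<Rightarrow> real) \<Rightarrow> 'l set \<Rightarrow> real" where
  "density_wrt N A = Lim at_top (density_quotient N A)"

text \<open>The common value of the densities with respect to all norms.\<close>

definition lattice_density :: "'l::ab_group_add set \<Rightarrow> real" where
  "lattice_density A = (THE d. \<forall>N. is_norm N \<longrightarrow> density_exists N A \<and> density_wrt N A = d)"

text \<open>Number of cosets. A periodic subgroup of a free module of finite rank contains \<open>p L\<close> for a
  period \<open>p\<close>, so the index is finite there (\<open>card\<close> would give 0 for infinite index).\<close>

definition subgroup_index :: "'l::ab_group_add set \<Rightarrow> nat" where
  "subgroup_index A = card {(\<lambda>a. x + a) ` A | x. True}"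

end

theory Submission
  imports Defs
begin

text \<open>
  Let \<open>\<varpi>\<close> be a period of \<open>A\<close>. Then \<open>A\<close> is a union of residue classes modulo \<open>\<varpi>L\<close>, and the fundamental
  box contains exactly one element of every class (\<open>box_remainder\<close>, \<open>box_remainder_unique\<close>). So the
  density formula follows once all residue classes are known to have asymptotically the same number of
  points in large balls (\<open>shifted_ball_count_ratio\<close>). A class is a translate \<open>f + \<varpi>L\<close>, and
  translation changes norms by at most \<open>K = N f\<close>; hence it suffices that the number \<open>T r\<close> of points of
  a lattice in the ball of radius \<open>r\<close> satisfies \<open>T (r + K) / T r \<longlonglongrightarrow> 1\<close> (\<open>ball_count_ratio\<close>).

  This is usually read off from the asymptotics of \<open>T r\<close> in terms of volumes. Here it is proved directly
  (\<open>card_shell_bound\<close>): many scaled and rounded copies of the shell between the radii \<open>r\<close> and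
  \<open>r + K\<close> fit disjointly into the ball of radius \<open>r\<close>, so the shell contains a negligible part of the
  points. The argument needs that balls contain finitely many lattice points and that lattice points are
  relatively dense. The first fact rests on the comparison of \<open>N\<close> with the coordinates
  (\<open>norm_bounds_coefficients\<close>), the second on rounding coordinates (\<open>lattice_in_real_tensor\<close>).

  The statements on sublattices and translates are then counts in the box: a translate of \<open>A\<close> has as many
  points in the box as \<open>A\<close> (\<open>card_box_translate\<close>), and for a sublattice \<open>A\<close> the box is the disjoint union
  of its intersections with the cosets of \<open>A\<close> (\<open>card_box_subgroup\<close>). For the independence of all choices,
  the density with respect to a norm does not mention \<open>\<varpi>\<close> and \<open>\<B>\<close>, while the quotient of cardinalities
  does not mention \<open>N\<close>; a norm exists by \<open>norm_exists\<close>.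
\<close>

section \<open>Norms on real vector spaces\<close>

lemma is_normD:
  assumes "is_norm N"
  shows "0 \<le> N x" "N x = 0 \<longleftrightarrow> x = 0" "N (c *\<^sub>R x) = \<bar>c\<bar> * N x" "N (x + y) \<le> N x + N y"
  using assms by (auto simp: is_norm_def)

lemma is_norm_zero: "is_norm N \<Longrightarrow> N 0 = 0"
  by (simp add: is_normD(2))

lemma is_norm_minus: "is_norm N \<Longrightarrow> N (- x) = N x"
  using is_normD(3)[of N "-1" x] by simp

lemma is_norm_minus_commute: "is_norm N \<Longrightarrow> N (x - y) = N (y - x)"
  using is_norm_minus[of N "x - y"] by simp

lemma is_norm_triangle_sub: "is_norm N \<Longrightarrow> N x \<le> N y + N (x - y)"
  using is_normD(4)[of N y "x - y"] by simp

lemma is_norm_sum: "is_norm N \<Longrightarrow> N (\<Sum>i\<in>I. f i) \<le> (\<Sum>i\<in>I. N (f i))"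
proof (induction I rule: infinite_finite_induct)
  case (insert i I)
  then show ?case using is_normD(4)[of N "f i" "sum f I"] by simp
qed (simp_all add: is_norm_zero)

section \<open>Growth of lattice point counts\<close>

text \<open>The counting argument uses only that the lattice is discrete (balls contain finitely many
  lattice points) and that every vector of the ambient space lies within a fixed distance \<open>D\<close> of a
  lattice point. Working with an additive map \<open>\<iota>\<close> instead of a subset lets the same results be
  used for the sublattice \<open>\<varpi>L\<close>, by taking \<open>\<iota> v = (\<varpi> v) \<otimes> 1\<close>.\<close>

locale lattice_in_normed =
  fixes N :: "'v::real_vector \<Rightarrow> real" and \<iota> :: "'l::ab_group_add \<Rightarrow> 'v"
  assumes norm: "is_norm N"
    and add: "\<iota> (v + w) = \<iota> v + \<iota> w"
    and finite_ball: "finite {v. N (\<iota> v) < r}"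
    and relatively_dense: "\<exists>D. \<forall>x. \<exists>v. N (x - \<iota> v) \<le> D"
begin

sublocale Modules.additive \<iota>
  by standard (rule add)

definition ball_count :: "real \<Rightarrow> nat" where
  "ball_count r = card {v. N (\<iota> v) < r}"

lemma ball_count_mono: "r \<le> s \<Longrightarrow> ball_count r \<le> ball_count s"
  unfolding ball_count_def by (rule card_mono[OF finite_ball]) auto

lemma ball_count_pos: "0 < r \<Longrightarrow> 0 < ball_count r"
proof -
  assume "0 < r"
  then have "0 \<in> {v. N (\<iota> v) < r}"
    using is_normD(2)[OF norm, of 0] by (simp add: zero)
  then show ?thesis
    unfolding ball_count_def using finite_ball card_gt_0_iff by blast
qed

text \<open>A shell of fixed thickness \<open>K\<close> at radius \<open>r\<close> can be shrunk towards the origin: multiply its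
  lattice points by a factor \<open>\<lambda> \<in> [1/2, 1]\<close> and round to a nearby lattice point. Rounding moves points
  by at most \<open>D\<close>, so at most \<open>C\<close> points get the same image, where \<open>C\<close> counts the lattice points in a
  ball of radius \<open>4 D + 1\<close>. If the factors are such that the
  radii decrease in steps of \<open>W > K + 2 D\<close>, the \<open>k\<close> shrunken shells are disjoint; all of them lie in the
  ball of radius \<open>r\<close>. Hence the shell holds at most a fraction \<open>C / k\<close> of the points of the ball, and
  \<open>k\<close> may grow with \<open>r\<close>. No volume is involved.\<close>

lemma card_shell_bound:
  assumes "0 \<le> K"
  shows "\<exists>(C::nat) W. 0 < W \<and> (\<forall>k r. 0 < r \<longrightarrow> 2 * real k * W \<le> r \<longrightarrow>
    k * card {v. r \<le> N (\<iota> v) \<and> N (\<iota> v) < r + K} \<le> C * ball_count r)"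
proof -
  obtain D where "\<forall>x. \<exists>v. N (x - \<iota> v) \<le> D"
    using relatively_dense by blast
  then obtain \<rho> where \<rho>: "N (x - \<iota> (\<rho> x)) \<le> D" for x
    by metis
  have D: "0 \<le> D"
    using \<rho>[of 0] is_normD(1)[OF norm] order_trans by blast
  define W where "W = K + 2 * D + 1"
  have W: "0 < W" using assms D by (simp add: W_def)
  define C where "C = ball_count (4 * D + 1)"
  show ?thesis
  proof (intro exI[of _ C] exI[of _ W] conjI allI impI)
    show "0 < W" by fact
    fix k :: nat and r :: real
    assume r: "0 < r" "2 * real k * W \<le> r"
    define S where "S = {v. r \<le> N (\<iota> v) \<and> N (\<iota> v) < r + K}"
    \<comment> \<open>The \<open>j\<close>-th factor takes radius \<open>r\<close> to \<open>r - j W\<close>; the condition on \<open>k\<close> makes every factor at least \<open>1/2\<close>.\<close>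
    define lam where "lam j = 1 - real j * W / r" for j
    define f where "f = (\<lambda>(j, v). \<rho> (lam j *\<^sub>R \<iota> v))"
    have finS: "finite S"
      by (rule finite_subset[OF _ finite_ball[of "r + K"]]) (auto simp: S_def)
    have lam: "1 / 2 \<le> lam j" "lam j \<le> 1" "lam j * r = r - real j * W" if "j \<in> {1..k}" for j
    proof -
      have "real j * W \<le> real k * W" using that W by simp
      then have "real j * W \<le> r / 2" using r by simp
      then show "1 / 2 \<le> lam j" using r by (simp add: lam_def field_simps)
      show "lam j \<le> 1" "lam j * r = r - real j * W"
        using r W by (simp_all add: lam_def field_simps)
    qed
    have image: "r - real j * W - D \<le> N (\<iota> (f (j, v)))" "N (\<iota> (f (j, v))) < r - real j * W + K + D"
      if j: "j \<in> {1..k}" and v: "v \<in> S" for j v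
    proof -
      have scaled: "N (lam j *\<^sub>R \<iota> v) = lam j * N (\<iota> v)"
        using lam(1)[OF j] by (simp add: is_normD(3)[OF norm])
      have close: "N (lam j *\<^sub>R \<iota> v - \<iota> (f (j, v))) \<le> D"
        by (simp add: f_def \<rho>)
      have "lam j * r \<le> lam j * N (\<iota> v)"
        using v lam(1)[OF j] by (simp add: S_def)
      then show "r - real j * W - D \<le> N (\<iota> (f (j, v)))"
        using is_norm_triangle_sub[OF norm, of "lam j *\<^sub>R \<iota> v" "\<iota> (f (j, v))"] close scaled lam(3)[OF j]
        by linarith
      have "lam j * N (\<iota> v) < lam j * (r + K)"
        using v lam(1)[OF j] by (simp add: S_def)
      also have "\<dots> \<le> lam j * r + K"
        using mult_right_mono[OF lam(2)[OF j] assms] by (simp add: distrib_left)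
      finally show "N (\<iota> (f (j, v))) < r - real j * W + K + D"
        using is_norm_triangle_sub[OF norm, of "\<iota> (f (j, v))" "lam j *\<^sub>R \<iota> v"] close scaled lam(3)[OF j]
          is_norm_minus_commute[OF norm, of "\<iota> (f (j, v))" "lam j *\<^sub>R \<iota> v"]
        by linarith
    qed
    have separated: "j \<le> i" if "i \<in> {1..k}" "j \<in> {1..k}" "v \<in> S" "w \<in> S" "f (i, v) = f (j, w)" for i j v w
    proof (rule ccontr)
      assume "\<not> j \<le> i"
      then have "real i + 1 \<le> real j" by simp
      from mult_right_mono[OF this, of W] have "real i * W + W \<le> real j * W"
        using W by (simp add: distrib_right)
      then show False
        using image(1)[of i v] image(2)[of j w] that by (simp add: W_def)
    qed
    \<comment> \<open>Two points of a fibre use the same factor, hence differ by at most \<open>2 D / \<lambda> \<le> 4 D\<close>.\<close>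
    have fibre: "card {x \<in> {1..k} \<times> S. f x = w} \<le> C" for w
    proof (cases "{x \<in> {1..k} \<times> S. f x = w} = {}")
      case False
      then obtain j v where jv: "j \<in> {1..k}" "v \<in> S" "f (j, v) = w" by auto
      have near: "i = j \<and> N (\<iota> (u - v)) < 4 * D + 1" if "i \<in> {1..k}" "u \<in> S" "f (i, u) = w" for i u
      proof -
        have i: "i = j"
          using separated[of i j u v] separated[of j i v u] that jv by simp
        have "N (lam j *\<^sub>R (\<iota> u - \<iota> v)) = N ((lam j *\<^sub>R \<iota> u - \<iota> w) - (lam j *\<^sub>R \<iota> v - \<iota> w))"
          by (simp add: scaleR_right_diff_distrib)
        also have "\<dots> \<le> N (lam j *\<^sub>R \<iota> u - \<iota> w) + N (lam j *\<^sub>R \<iota> v - \<iota> w)"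
          using is_normD(4)[OF norm, of "lam j *\<^sub>R \<iota> u - \<iota> w" "- (lam j *\<^sub>R \<iota> v - \<iota> w)"]
            is_norm_minus[OF norm, of "lam j *\<^sub>R \<iota> v - \<iota> w"] by simp
        also have "\<dots> \<le> 2 * D"
          using \<rho>[of "lam j *\<^sub>R \<iota> u"] \<rho>[of "lam j *\<^sub>R \<iota> v"] that jv i by (simp add: f_def)
        finally have "lam j * N (\<iota> (u - v)) \<le> 2 * D"
          using lam(1)[OF jv(1)] by (simp add: is_normD(3)[OF norm] diff)
        moreover have "1 / 2 * N (\<iota> (u - v)) \<le> lam j * N (\<iota> (u - v))"
          using lam(1)[OF jv(1)] is_normD(1)[OF norm] by (rule mult_right_mono)
        ultimately show ?thesis using i by simp
      qed
      have "{x \<in> {1..k} \<times> S. f x = w} \<subseteq> (\<lambda>u. (j, u + v)) ` {u. N (\<iota> u) < 4 * D + 1}"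
      proof
        fix x assume "x \<in> {x \<in> {1..k} \<times> S. f x = w}"
        then obtain i u where x: "x = (i, u)" "i \<in> {1..k}" "u \<in> S" "f (i, u) = w" by auto
        then show "x \<in> (\<lambda>u. (j, u + v)) ` {u. N (\<iota> u) < 4 * D + 1}"
          using near[of i u] by (intro image_eqI[of _ _ "u - v"]) auto
      qed
      then show ?thesis
        unfolding C_def ball_count_def by (rule surj_card_le[OF finite_ball])
    next
      case True
      then show ?thesis by (simp only: card.empty le0)
    qed
    have "f ` ({1..k} \<times> S) \<subseteq> {v. N (\<iota> v) < r}"
    proof clarify
      fix j v assume jv: "j \<in> {1..k}" "v \<in> S"
      then have "1 * W \<le> real j * W" using W by (intro mult_right_mono) auto
      then show "N (\<iota> (f (j, v))) < r"
        using image(2)[OF jv] D by (simp add: W_def)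
    qed
    then have "{1..k} \<times> S = (\<Union>w \<in> {v. N (\<iota> v) < r}. {x \<in> {1..k} \<times> S. f x = w})"
      by blast
    then have "card ({1..k} \<times> S) = card (\<Union>w \<in> {v. N (\<iota> v) < r}. {x \<in> {1..k} \<times> S. f x = w})"
      by (rule arg_cong)
    also have "\<dots> \<le> (\<Sum>w \<in> {v. N (\<iota> v) < r}. card {x \<in> {1..k} \<times> S. f x = w})"
      by (rule card_UN_le[OF finite_ball])
    also have "\<dots> \<le> card {v. N (\<iota> v) < r} * C"
      using sum_bounded_above[of "{v. N (\<iota> v) < r}" "\<lambda>w. card {x \<in> {1..k} \<times> S. f x = w}" C] fibre by simp
    finally show "k * card {v. r \<le> N (\<iota> v) \<and> N (\<iota> v) < r + K} \<le> C * ball_count r"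
      by (simp add: card_cartesian_product S_def ball_count_def mult.commute)
  qed
qed

lemma ball_count_ratio:
  assumes "0 \<le> K"
  shows "((\<lambda>r. real (ball_count (r + K)) / real (ball_count r)) \<longlongrightarrow> 1) at_top"
proof -
  obtain C :: nat and W :: real where W: "0 < W" and bound:
    "\<And>k r. 0 < r \<Longrightarrow> 2 * real k * W \<le> r \<Longrightarrow>
       k * card {v. r \<le> N (\<iota> v) \<and> N (\<iota> v) < r + K} \<le> C * ball_count r"
    using card_shell_bound[OF assms] by blast
  have split: "ball_count (r + K) = ball_count r + card {v. r \<le> N (\<iota> v) \<and> N (\<iota> v) < r + K}" for r
  proof -
    have "{v. N (\<iota> v) < r + K} = {v. N (\<iota> v) < r} \<union> {v. r \<le> N (\<iota> v) \<and> N (\<iota> v) < r + K}"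
      using assms by auto
    moreover have "finite {v. r \<le> N (\<iota> v) \<and> N (\<iota> v) < r + K}"
      by (rule finite_subset[OF _ finite_ball[of "r + K"]]) auto
    moreover have "{v. N (\<iota> v) < r} \<inter> {v. r \<le> N (\<iota> v) \<and> N (\<iota> v) < r + K} = {}"
      by auto
    ultimately show ?thesis
      unfolding ball_count_def by (simp only: card_Un_disjoint[OF finite_ball])
  qed
  show ?thesis
  proof (rule tendstoI)
    fix e :: real assume e: "0 < e"
    obtain k :: nat where k: "real C / e < real k"
      using reals_Archimedean2 by blast
    have k0: "0 < real k" using le_less_trans[OF _ k, of 0] e by simp
    show "\<forall>\<^sub>F r in at_top. dist (real (ball_count (r + K)) / real (ball_count r)) 1 < e"
      using eventually_ge_at_top[of "2 * real k * W"] eventually_gt_at_top[of 0]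
    proof eventually_elim
      case (elim r)
      define s where "s = real (card {v. r \<le> N (\<iota> v) \<and> N (\<iota> v) < r + K})"
      have pos: "0 < real (ball_count r)" using ball_count_pos[OF elim(2)] by simp
      have "real k * s \<le> real C * real (ball_count r)"
        using bound[OF elim(2,1)] unfolding s_def by (simp flip: of_nat_mult)
      also have "\<dots> < e * real k * real (ball_count r)"
        using k e pos by (simp add: field_simps)
      finally have "s < e * real (ball_count r)"
        using k0 by (simp add: mult.assoc mult.left_commute)
      then have "s / real (ball_count r) < e"
        using pos by (simp add: field_simps)
      moreover have "0 \<le> s / real (ball_count r)" by (simp add: s_def)
      moreover have "real (ball_count (r + K)) / real (ball_count r) = 1 + s / real (ball_count r)"
        using pos by (simp add: split s_def add_divide_distrib)
      ultimately show ?case by (simp only: dist_real_def)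
    qed
  qed
qed

text \<open>Translating by \<open>x\<close> changes norms by at most \<open>K = N x\<close>, so the count for the translate lies between
  the counts for the lattice at the radii \<open>r - K\<close> and \<open>r + K\<close>.\<close>

lemma shifted_ball_count_ratio:
  "((\<lambda>r. real (card {v. N (x + \<iota> v) < r}) / real (ball_count r)) \<longlongrightarrow> 1) at_top"
proof -
  define K where "K = N x"
  have K: "0 \<le> K" by (simp add: K_def is_normD(1)[OF norm])
  have upper: "((\<lambda>r. real (ball_count (r + K)) / real (ball_count r)) \<longlongrightarrow> 1) at_top"
    by (rule ball_count_ratio[OF K])
  have "filterlim (\<lambda>r. r - K) at_top at_top"
    using filterlim_tendsto_add_at_top[OF tendsto_const[of "- K"] filterlim_ident] by simp
  from tendsto_inverse[OF filterlim_compose[OF ball_count_ratio[OF K] this]]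
  have "((\<lambda>r. inverse (real (ball_count (r - K + K)) / real (ball_count (r - K)))) \<longlongrightarrow> inverse 1) at_top"
    by simp
  then have lower: "((\<lambda>r. real (ball_count (r - K)) / real (ball_count r)) \<longlongrightarrow> 1) at_top"
    by simp
  have sub: "{v. N (x + \<iota> v) < r} \<subseteq> {v. N (\<iota> v) < r + K}" for r
  proof clarify
    fix v assume "N (x + \<iota> v) < r"
    then show "N (\<iota> v) < r + K"
      using is_norm_triangle_sub[OF norm, of "\<iota> v" "x + \<iota> v"] is_norm_minus[OF norm, of x]
      by (simp add: K_def)
  qed
  have "card {v. N (x + \<iota> v) < r} \<le> ball_count (r + K)" for r
    unfolding ball_count_def by (rule card_mono[OF finite_ball sub])
  then have le_upper: "\<forall>\<^sub>F r in at_top. real (card {v. N (x + \<iota> v) < r}) / real (ball_count r)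
      \<le> real (ball_count (r + K)) / real (ball_count r)"
    by (simp add: divide_right_mono)
  have "{v. N (\<iota> v) < r - K} \<subseteq> {v. N (x + \<iota> v) < r}" for r
  proof clarify
    fix v assume "N (\<iota> v) < r - K"
    then show "N (x + \<iota> v) < r"
      using is_normD(4)[OF norm, of x "\<iota> v"] by (simp add: K_def)
  qed
  then have "ball_count (r - K) \<le> card {v. N (x + \<iota> v) < r}" for r
    unfolding ball_count_def using finite_subset[OF sub finite_ball] by (simp add: card_mono)
  then have ge_lower: "\<forall>\<^sub>F r in at_top. real (ball_count (r - K)) / real (ball_count r)
      \<le> real (card {v. N (x + \<iota> v) < r}) / real (ball_count r)"
    by (simp add: divide_right_mono)
  show ?thesis
    by (rule tendsto_sandwich[OF ge_lower le_upper lower upper])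
qed

end

section \<open>Discreteness: a norm controls coefficients\<close>

lemma compact_product_functions:
  fixes X :: "'i \<Rightarrow> real set"
  assumes "\<And>i. compact (X i)"
  shows "compact {x. \<forall>i. x i \<in> X i}"
proof -
  have "{x. \<forall>i. x i \<in> X i} = PiE UNIV X" by auto
  moreover have "compactin (product_topology (\<lambda>_. euclidean) UNIV) (PiE UNIV X)"
    using assms by (simp add: compactin_PiE)
  ultimately show ?thesis
    by (simp add: euclidean_product_topology)
qed

text \<open>The coefficient vectors whose absolute values add up to one form a compact set in the product
  topology (once coefficients outside \<open>S\<close> are set to zero), on which the norm of the combination is continuous and, by independence, positive; its minimum there is the
  constant \<open>c\<close>, by homogeneity.\<close>

lemma norm_bounds_coefficients:
  fixes N :: "'v::real_vector \<Rightarrow> real" and e :: "'i \<Rightarrow> 'v"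
  assumes N: "is_norm N" and S: "finite S"
    and indep: "\<And>x i. (\<Sum>i\<in>S. x i *\<^sub>R e i) = 0 \<Longrightarrow> i \<in> S \<Longrightarrow> x i = 0"
  shows "\<exists>c>0. \<forall>x. c * (\<Sum>i\<in>S. \<bar>x i\<bar>) \<le> N (\<Sum>i\<in>S. x i *\<^sub>R e i)"
proof (cases "S = {}")
  case True
  then show ?thesis using is_normD(1)[OF N] by (intro exI[of _ 1]) simp
next
  case False
  define E where "E x = (\<Sum>i\<in>S. x i *\<^sub>R e i)" for x
  define K where "K = {x. \<forall>i. x i \<in> (if i \<in> S then {-1..1} else {0::real})} \<inter> {x. (\<Sum>i\<in>S. \<bar>x i\<bar>) = 1}"
  have E_diff: "E x - E y = E (\<lambda>i. x i - y i)" for x y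
    by (simp add: E_def scaleR_left_diff_distrib sum_subtractf)
  have coord: "continuous_on UNIV (\<lambda>x :: 'i \<Rightarrow> real. x i)" for i
    by simp
  have "closed {x. (\<Sum>i\<in>S. \<bar>x i :: real\<bar>) = 1}"
    by (intro closed_Collect_eq continuous_intros coord)
  then have K: "compact K"
    unfolding K_def by (intro compact_Int_closed compact_product_functions) auto
  have NE: "N (E x) \<le> (\<Sum>i\<in>S. \<bar>x i\<bar> * N (e i))" for x
    using is_norm_sum[OF N, of "\<lambda>i. x i *\<^sub>R e i" S] by (simp add: E_def is_normD(3)[OF N])
  have "continuous_on UNIV (\<lambda>x. N (E x))"
    unfolding continuous_on_def
  proof
    fix y :: "'i \<Rightarrow> real"
    have "((\<lambda>x. \<Sum>i\<in>S. \<bar>x i - y i\<bar> * N (e i)) \<longlongrightarrow> (\<Sum>i\<in>S. \<bar>y i - y i\<bar> * N (e i))) (at y)"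
      using coord by (intro tendsto_intros) (simp add: continuous_on_def)
    then have "((\<lambda>x. \<Sum>i\<in>S. \<bar>x i - y i\<bar> * N (e i)) \<longlongrightarrow> 0) (at y)" by simp
    moreover have "\<bar>N (E x) - N (E y)\<bar> \<le> (\<Sum>i\<in>S. \<bar>x i - y i\<bar> * N (e i))" for x
      using is_norm_triangle_sub[OF N, of "E x" "E y"] is_norm_triangle_sub[OF N, of "E y" "E x"]
        is_norm_minus_commute[OF N, of "E x" "E y"] NE[of "\<lambda>i. x i - y i"]
      by (simp add: E_diff)
    ultimately have "((\<lambda>x. N (E x) - N (E y)) \<longlongrightarrow> 0) (at y)"
      by (intro Lim_null_comparison[of "\<lambda>x. N (E x) - N (E y)"]) simp_all
    then show "((\<lambda>x. N (E x)) \<longlongrightarrow> N (E y)) (at y)"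
      by (rule LIM_zero_cancel)
  qed
  then have cont: "continuous_on K (\<lambda>x. N (E x))"
    by (rule continuous_on_subset) simp
  \<comment> \<open>A unit vector shows that the sphere \<open>K\<close> is nonempty.\<close>
  obtain i0 where i0: "i0 \<in> S" using False by blast
  have "(\<lambda>i. if i = i0 then 1 else 0) \<in> K"
    using i0 S by (auto simp: K_def if_distrib[of abs] cong: if_cong)
  then obtain x0 where x0: "x0 \<in> K" "\<And>x. x \<in> K \<Longrightarrow> N (E x0) \<le> N (E x)"
    using continuous_attains_inf[OF K _ cont] by blast
  have "N (E x0) \<noteq> 0"
  proof
    assume "N (E x0) = 0"
    then have "\<And>i. i \<in> S \<Longrightarrow> x0 i = 0"
      using indep is_normD(2)[OF N] unfolding E_def by blast
    then have "(\<Sum>i\<in>S. \<bar>x0 i\<bar>) = 0" by simp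
    then show False using x0(1) by (simp add: K_def)
  qed
  then have pos: "0 < N (E x0)" using is_normD(1)[OF N, of "E x0"] by simp
  have "N (E x0) * (\<Sum>i\<in>S. \<bar>x i\<bar>) \<le> N (E x)" for x
  proof (cases "(\<Sum>i\<in>S. \<bar>x i\<bar>) = 0")
    case True
    then show ?thesis using is_normD(1)[OF N] by simp
  next
    case False
    define s where "s = (\<Sum>i\<in>S. \<bar>x i\<bar>)"
    have s: "0 < s" using False unfolding s_def by (simp add: less_le sum_nonneg)
    define y where "y i = (if i \<in> S then x i / s else 0)" for i
    have "\<bar>x i\<bar> \<le> s" if "i \<in> S" for i
      unfolding s_def using S that by (intro member_le_sum) auto
    then have "y i \<in> {-1..1}" if "i \<in> S" for i
      using that s by (simp add: y_def abs_le_iff pos_le_divide_eq pos_divide_le_eq minus_le_iff)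
    moreover have "(\<Sum>i\<in>S. \<bar>y i\<bar>) = 1"
      using s by (simp add: y_def s_def[symmetric] flip: sum_divide_distrib)
    ultimately have "y \<in> K"
      by (simp add: K_def y_def)
    then have "N (E x0) \<le> N (E y)" by (rule x0(2))
    also have "E y = (1 / s) *\<^sub>R E x"
      by (simp add: E_def y_def scaleR_sum_right)
    finally show ?thesis
      using s by (simp add: is_normD(3)[OF N] s_def[symmetric] field_simps)
  qed
  then show ?thesis using pos by (auto simp: E_def)
qed

section \<open>Coordinates on a free module and on its extension of scalars\<close>

text \<open>The finitely many elements of some finite basis use only a finite part \<open>U\<close> of \<open>B\<close> in their
  expansions, so \<open>U\<close> already spans and independence leaves nothing outside \<open>U\<close>.\<close>

lemma finite_of_is_basis:
  fixes zscale :: "int \<Rightarrow> 'l::ab_group_add \<Rightarrow> 'l"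
  assumes free: "is_free_of_rank zscale n" and B: "is_basis zscale B"
  shows "finite B"
proof -
  interpret module zscale using free by (simp add: is_free_of_rank_def)
  obtain B0 where B0: "span B0 = UNIV" "finite B0"
    using free by (auto simp: is_free_of_rank_def is_basis_def)
  have "\<exists>T. finite T \<and> T \<subseteq> B \<and> b \<in> span T" for b
  proof -
    have "b \<in> span B" using B by (simp add: is_basis_def)
    then obtain T c where "finite T" "T \<subseteq> B" "b = (\<Sum>a\<in>T. zscale (c a) a)"
      unfolding span_explicit by blast
    then show ?thesis by (blast intro: span_sum span_scale span_base)
  qed
  then obtain T where T: "\<And>b. finite (T b)" "\<And>b. T b \<subseteq> B" "\<And>b. b \<in> span (T b)" by metis
  define U where "U = (\<Union>b\<in>B0. T b)"
  have U: "finite U" "U \<subseteq> B" using T B0(2) by (auto simp: U_def)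
  have "B0 \<subseteq> span U"
  proof
    fix b assume "b \<in> B0"
    then have "T b \<subseteq> U" by (auto simp: U_def)
    then show "b \<in> span U" using T(3) span_mono by blast
  qed
  then have "span U = UNIV" using B0(1) span_minimal[OF _ subspace_span] by blast
  have "x \<in> U" if x: "x \<in> B" for x
  proof (rule ccontr)
    assume "x \<notin> U"
    have "x \<in> span U" using \<open>span U = UNIV\<close> by simp
    then obtain c where c: "x = (\<Sum>a\<in>U. zscale (c a) a)"
      by (auto simp: span_finite[OF U(1)])
    define d where "d a = (if a = x then - 1 else c a)" for a
    have "(\<Sum>a\<in>U. zscale (d a) a) = (\<Sum>a\<in>U. zscale (c a) a)"
      by (rule sum.cong) (use \<open>x \<notin> U\<close> in \<open>auto simp: d_def\<close>)
    then have "(\<Sum>a\<in>insert x U. zscale (d a) a) = 0"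
      using U(1) \<open>x \<notin> U\<close> c by (simp add: d_def)
    then have "d x = 0"
      using independentD[of B "insert x U" d x] B U x by (simp add: is_basis_def)
    then show False by (simp add: d_def)
  qed
  then have "B \<subseteq> U" by blast
  then show ?thesis using U(1) by (rule finite_subset)
qed

locale free_int_module = module zscale
  for zscale :: "int \<Rightarrow> 'l::ab_group_add \<Rightarrow> 'l" +
  fixes B :: "'l set"
  assumes finite_basis: "finite B" and basis: "is_basis zscale B"
begin

definition combination :: "('l \<Rightarrow> int) \<Rightarrow> 'l" where
  "combination c = (\<Sum>b\<in>B. zscale (c b) b)"

text \<open>Only the values on \<open>B\<close> are meaningful: outside \<open>B\<close> the chosen function is arbitrary.\<close>

definition coordinates :: "'l \<Rightarrow> 'l \<Rightarrow> int" where
  "coordinates v = (SOME c. combination c = v)"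

lemma combination_coordinates [simp]: "combination (coordinates v) = v"
proof -
  have "v \<in> span B" using basis by (simp add: is_basis_def)
  then have "\<exists>c. combination c = v"
    by (auto simp: span_finite[OF finite_basis] combination_def)
  then show ?thesis unfolding coordinates_def by (rule someI_ex)
qed

lemma combination_add: "combination (\<lambda>b. c b + d b) = combination c + combination d"
  by (simp add: combination_def scale_left_distrib sum.distrib)

lemma combination_scale: "combination (\<lambda>b. k * c b) = zscale k (combination c)"
  by (simp add: combination_def scale_sum_right)

lemma combination_inject:
  assumes "combination c = combination d" "b \<in> B"
  shows "c b = d b"
proof -
  have "(\<Sum>b\<in>B. zscale (c b - d b) b) = 0"
    using assms(1) by (simp add: combination_def scale_left_diff_distrib sum_subtractf)
  then have "c b - d b = 0"
    using basis assms(2) finite_basis independentD[of B B "\<lambda>b. c b - d b" b] by (simp add: is_basis_def)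
  then show ?thesis by simp
qed

lemma coordinates_combination: "b \<in> B \<Longrightarrow> coordinates (combination c) b = c b"
  by (rule combination_inject) simp_all

lemma coordinates_add: "b \<in> B \<Longrightarrow> coordinates (v + w) b = coordinates v b + coordinates w b"
  by (rule combination_inject) (simp_all add: combination_add)

lemma coordinates_scale: "b \<in> B \<Longrightarrow> coordinates (zscale k v) b = k * coordinates v b"
  by (rule combination_inject) (simp_all add: combination_scale)

lemma coordinates_eqI: "(\<And>b. b \<in> B \<Longrightarrow> coordinates v b = coordinates w b) \<Longrightarrow> v = w"
  using combination_coordinates[of v] combination_coordinates[of w]
  by (metis (no_types, lifting) combination_def sum.cong)

lemma zscale_inject: "p \<noteq> 0 \<Longrightarrow> zscale p v = zscale p w \<Longrightarrow> v = w"
  by (rule coordinates_eqI) (metis coordinates_scale mult_cancel_left)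

text \<open>The linear extension of a coordinate to the real vector space is supplied by the universal
  property of the tensor product, which needs additivity; this is available for \<open>b \<in> B\<close>.\<close>

definition real_coordinate :: "'l \<Rightarrow> 'l real_tensor \<Rightarrow> real" where
  "real_coordinate b = (SOME g. linear g \<and> (\<forall>v. g (v \<otimes>\<^sub>\<real> 1) = of_int (coordinates v b)))"

lemma real_coordinate:
  assumes "b \<in> B"
  shows linear_real_coordinate: "linear (real_coordinate b)"
    and real_coordinate_tensor: "real_coordinate b (v \<otimes>\<^sub>\<real> r) = r * of_int (coordinates v b)"
proof -
  have "Modules.additive (\<lambda>v. real_of_int (coordinates v b))"
    by standard (simp add: coordinates_add[OF assms])
  from ex1_implies_ex[OF real_tensor_universal[OF this]]
  have *: "linear (real_coordinate b) \<and> (\<forall>v. real_coordinate b (v \<otimes>\<^sub>\<real> 1) = of_int (coordinates v b))"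
    unfolding real_coordinate_def by (rule someI_ex)
  then show "linear (real_coordinate b)" by simp
  have "v \<otimes>\<^sub>\<real> r = r *\<^sub>R (v \<otimes>\<^sub>\<real> 1)" by (simp add: scaleR_tensor)
  then show "real_coordinate b (v \<otimes>\<^sub>\<real> r) = r * of_int (coordinates v b)"
    using * by (simp add: linear_scale)
qed

lemma tensor_sum: "(\<Sum>i\<in>I. f i) \<otimes>\<^sub>\<real> r = (\<Sum>i\<in>I. f i \<otimes>\<^sub>\<real> r)" for f :: "'i \<Rightarrow> 'l"
proof -
  interpret T: Modules.additive "\<lambda>v::'l. v \<otimes>\<^sub>\<real> r" by standard (rule tensor_add_left)
  show ?thesis by (rule T.sum)
qed

lemma combination_tensor: "combination c \<otimes>\<^sub>\<real> 1 = (\<Sum>b\<in>B. of_int (c b) *\<^sub>R (b \<otimes>\<^sub>\<real> 1))"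
  by (simp add: combination_def tensor_sum tensor_balanced[OF module_axioms] scaleR_tensor)

lemma basis_expansion:
  fixes x :: "'l real_tensor"
  shows "x = (\<Sum>b\<in>B. real_coordinate b x *\<^sub>R (b \<otimes>\<^sub>\<real> 1))"
proof (induction x rule: real_tensor_induct)
  case (tensor v r)
  have "v \<otimes>\<^sub>\<real> r = r *\<^sub>R (combination (coordinates v) \<otimes>\<^sub>\<real> 1)" by (simp add: scaleR_tensor)
  also have "\<dots> = (\<Sum>b\<in>B. real_coordinate b (v \<otimes>\<^sub>\<real> r) *\<^sub>R (b \<otimes>\<^sub>\<real> 1))"
    by (simp only: combination_tensor scaleR_sum_right scaleR_scaleR real_coordinate_tensor cong: sum.cong)
  finally show ?case .
next
  case (diff x y)
  have "(\<Sum>b\<in>B. real_coordinate b (x - y) *\<^sub>R (b \<otimes>\<^sub>\<real> 1))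
      = (\<Sum>b\<in>B. real_coordinate b x *\<^sub>R (b \<otimes>\<^sub>\<real> 1)) - (\<Sum>b\<in>B. real_coordinate b y *\<^sub>R (b \<otimes>\<^sub>\<real> 1))"
    by (simp add: linear_diff[OF linear_real_coordinate] scaleR_left_diff_distrib sum_subtractf)
  then show ?case using diff by simp
qed

text \<open>Together with the expansion above, this says that the vectors \<open>b \<otimes> 1\<close> form a real basis.\<close>

lemma real_coordinate_sum:
  assumes "b \<in> B"
  shows "real_coordinate b (\<Sum>a\<in>B. x a *\<^sub>R (a \<otimes>\<^sub>\<real> 1)) = x b"
proof -
  have unit: "coordinates a b = (if a = b then 1 else 0)" if "a \<in> B" for a
  proof -
    have "combination (\<lambda>c. if c = a then 1 else 0) = a"
      using that finite_basis
      by (simp add: combination_def if_distrib[of "\<lambda>k. zscale k _"] cong: if_cong)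
    then show ?thesis
      using coordinates_combination[OF assms, of "\<lambda>c. if c = a then 1 else 0"] by auto
  qed
  have "real_coordinate b (\<Sum>a\<in>B. x a *\<^sub>R (a \<otimes>\<^sub>\<real> 1)) = (\<Sum>a\<in>B. x a * of_int (coordinates a b))"
    using linear_real_coordinate[OF assms]
    by (simp add: linear_sum linear_scale real_coordinate_tensor[OF assms])
  also have "\<dots> = (\<Sum>a\<in>B. if a = b then x a else 0)"
    by (rule sum.cong) (simp_all add: unit)
  also have "\<dots> = x b" using assms finite_basis by simp
  finally show ?thesis .
qed

lemma norm_exists: "\<exists>N :: 'l real_tensor \<Rightarrow> real. is_norm N"
proof
  show "is_norm (\<lambda>x. \<Sum>b\<in>B. \<bar>real_coordinate b x\<bar>)"
    unfolding is_norm_def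
  proof (intro conjI allI)
    fix x y :: "'l real_tensor" and c :: real
    show "0 \<le> (\<Sum>b\<in>B. \<bar>real_coordinate b x\<bar>)" by (simp add: sum_nonneg)
    show "(\<Sum>b\<in>B. \<bar>real_coordinate b x\<bar>) = 0 \<longleftrightarrow> x = 0"
    proof
      assume "(\<Sum>b\<in>B. \<bar>real_coordinate b x\<bar>) = 0"
      then have "\<And>b. b \<in> B \<Longrightarrow> real_coordinate b x = 0"
        using finite_basis by (simp add: sum_nonneg_eq_0_iff)
      then show "x = 0" by (subst basis_expansion) simp
    qed (simp add: linear_0[OF linear_real_coordinate])
    show "(\<Sum>b\<in>B. \<bar>real_coordinate b (c *\<^sub>R x)\<bar>) = \<bar>c\<bar> * (\<Sum>b\<in>B. \<bar>real_coordinate b x\<bar>)"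
      by (simp add: linear_scale[OF linear_real_coordinate] abs_mult sum_distrib_left)
    show "(\<Sum>b\<in>B. \<bar>real_coordinate b (x + y)\<bar>)
        \<le> (\<Sum>b\<in>B. \<bar>real_coordinate b x\<bar>) + (\<Sum>b\<in>B. \<bar>real_coordinate b y\<bar>)"
      by (simp add: linear_add[OF linear_real_coordinate] sum.distrib[symmetric] sum_mono)
  qed
qed

text \<open>A bound on the norm bounds all coordinates, and these are integers.\<close>

lemma finite_norm_ball:
  fixes N :: "'l real_tensor \<Rightarrow> real"
  assumes "is_norm N"
  shows "finite {v. N (v \<otimes>\<^sub>\<real> 1) < r}"
proof -
  have "\<exists>c>0. \<forall>x. c * (\<Sum>b\<in>B. \<bar>x b\<bar>) \<le> N (\<Sum>b\<in>B. x b *\<^sub>R (b \<otimes>\<^sub>\<real> 1))"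
  proof (rule norm_bounds_coefficients[OF assms finite_basis])
    fix x b assume "(\<Sum>a\<in>B. x a *\<^sub>R (a \<otimes>\<^sub>\<real> 1)) = 0" "b \<in> B"
    then show "x b = 0"
      using real_coordinate_sum[of b x] linear_0[OF linear_real_coordinate[of b]] by simp
  qed
  then obtain c where c: "0 < c" "\<And>x. c * (\<Sum>b\<in>B. \<bar>x b\<bar>) \<le> N (\<Sum>b\<in>B. x b *\<^sub>R (b \<otimes>\<^sub>\<real> 1))"
    by blast
  define m where "m = \<lceil>r / c\<rceil>"
  have "{v. N (v \<otimes>\<^sub>\<real> 1) < r} \<subseteq> combination ` (PiE B (\<lambda>_. {-m..m}))"
  proof clarify
    fix v assume v: "N (v \<otimes>\<^sub>\<real> 1) < r"
    have "coordinates v b \<in> {-m..m}" if b: "b \<in> B" for b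
    proof -
      have "\<bar>real_of_int (coordinates v b)\<bar> \<le> (\<Sum>b\<in>B. \<bar>real_of_int (coordinates v b)\<bar>)"
        using b finite_basis by (intro member_le_sum) auto
      then have "c * \<bar>real_of_int (coordinates v b)\<bar> \<le> c * (\<Sum>b\<in>B. \<bar>real_of_int (coordinates v b)\<bar>)"
        using c(1) by simp
      also have "\<dots> \<le> N (v \<otimes>\<^sub>\<real> 1)"
        using c(2)[of "\<lambda>b. of_int (coordinates v b)"] combination_tensor[of "coordinates v"] by simp
      finally have "\<bar>real_of_int (coordinates v b)\<bar> \<le> r / c"
        using v c(1) by (simp add: field_simps)
      then show ?thesis unfolding m_def atLeastAtMost_iff by linarith
    qed
    moreover have "combination (restrict (coordinates v) B) = v"
      using combination_coordinates[of v] by (simp add: combination_def)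
    ultimately show "v \<in> combination ` (PiE B (\<lambda>_. {-m..m}))"
      by (intro image_eqI[of _ _ "restrict (coordinates v) B"]) auto
  qed
  then show ?thesis
    by (rule finite_subset) (simp add: finite_PiE finite_basis)
qed

text \<open>Rounding each real coordinate down to a multiple of \<open>p\<close> approximates a vector by a point of
  \<open>p L\<close> and leaves a remainder in the parallelepiped spanned by the vectors \<open>p (b \<otimes> 1)\<close>, which is bounded.\<close>

lemma lattice_in_real_tensor:
  assumes N: "is_norm N" and p: "0 < p"
  shows "lattice_in_normed N (\<lambda>v. zscale p v \<otimes>\<^sub>\<real> 1)"
proof
  show "is_norm N" by fact
  show "zscale p (v + w) \<otimes>\<^sub>\<real> 1 = zscale p v \<otimes>\<^sub>\<real> 1 + zscale p w \<otimes>\<^sub>\<real> 1" for v w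
    by (simp add: scale_right_distrib tensor_add_left)
  show "finite {v. N (zscale p v \<otimes>\<^sub>\<real> 1) < r}" for r
  proof -
    have "zscale p -` {v. N (v \<otimes>\<^sub>\<real> 1) < r} = {v. N (zscale p v \<otimes>\<^sub>\<real> 1) < r}" by auto
    moreover have "inj (zscale p)" by (rule injI, rule zscale_inject[of p]) (use p in auto)
    ultimately show ?thesis using finite_vimageI[OF finite_norm_ball[OF N, of r]] by metis
  qed
  show "\<exists>D. \<forall>x. \<exists>v. N (x - zscale p v \<otimes>\<^sub>\<real> 1) \<le> D"
  proof (rule exI[of _ "\<Sum>b\<in>B. p * N (b \<otimes>\<^sub>\<real> 1)"], rule allI)
    fix x
    define v where "v = combination (\<lambda>b. \<lfloor>real_coordinate b x / p\<rfloor>)"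
    define y where "y b = real_coordinate b x - p * \<lfloor>real_coordinate b x / p\<rfloor>" for b
    have y: "0 \<le> y b" "y b \<le> p" for b
    proof -
      have "real_of_int p * real_of_int \<lfloor>real_coordinate b x / p\<rfloor> \<le> real_of_int p * (real_coordinate b x / p)"
        using p by (intro mult_left_mono) simp_all
      moreover have "real_of_int p * (real_coordinate b x / p) \<le> real_of_int p * (real_of_int \<lfloor>real_coordinate b x / p\<rfloor> + 1)"
        using p real_of_int_floor_add_one_ge by (intro mult_left_mono) simp_all
      ultimately show "0 \<le> y b" "y b \<le> p" using p by (simp_all add: y_def distrib_left)
    qed
    have "zscale p v \<otimes>\<^sub>\<real> 1 = (\<Sum>b\<in>B. (p * \<lfloor>real_coordinate b x / p\<rfloor>) *\<^sub>R (b \<otimes>\<^sub>\<real> 1))"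
      unfolding v_def combination_scale[symmetric] combination_tensor by simp
    then have "x - zscale p v \<otimes>\<^sub>\<real> 1 = (\<Sum>b\<in>B. y b *\<^sub>R (b \<otimes>\<^sub>\<real> 1))"
      by (subst basis_expansion[of x]) (simp add: y_def scaleR_left_diff_distrib sum_subtractf)
    then have "N (x - zscale p v \<otimes>\<^sub>\<real> 1) \<le> (\<Sum>b\<in>B. N (y b *\<^sub>R (b \<otimes>\<^sub>\<real> 1)))"
      using is_norm_sum[OF N] by simp
    also have "\<dots> \<le> (\<Sum>b\<in>B. p * N (b \<otimes>\<^sub>\<real> 1))"
      using y is_normD(1)[OF N] by (intro sum_mono) (simp add: is_normD(3)[OF N] mult_right_mono)
    finally show "\<exists>v. N (x - zscale p v \<otimes>\<^sub>\<real> 1) \<le> (\<Sum>b\<in>B. p * N (b \<otimes>\<^sub>\<real> 1))" by blast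
  qed
qed

section \<open>The fundamental box represents the residues modulo a period\<close>

lemma finite_fundamental_box: "finite (fundamental_box zscale B p)"
proof -
  have "fundamental_box zscale B p \<subseteq> combination ` (PiE B (\<lambda>_. {0..<p}))"
  proof
    fix v assume "v \<in> fundamental_box zscale B p"
    then obtain c where "v = combination c" "\<forall>b\<in>B. 0 \<le> c b \<and> c b < p"
      by (auto simp: fundamental_box_def combination_def)
    then show "v \<in> combination ` (PiE B (\<lambda>_. {0..<p}))"
      by (intro image_eqI[of _ _ "restrict c B"]) (auto simp: combination_def)
  qed
  then show ?thesis by (rule finite_subset) (simp add: finite_PiE finite_basis)
qed

lemma box_remainder:
  assumes "0 < p"
  shows "\<exists>f\<in>fundamental_box zscale B p. \<exists>w. v = f + zscale p w"
proof (intro bexI exI)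
  show "v = combination (\<lambda>b. coordinates v b mod p) + zscale p (combination (\<lambda>b. coordinates v b div p))"
    by (simp flip: combination_scale combination_add)
  show "combination (\<lambda>b. coordinates v b mod p) \<in> fundamental_box zscale B p"
    using assms by (auto simp: fundamental_box_def combination_def)
qed

lemma box_remainder_unique:
  assumes "f \<in> fundamental_box zscale B p" "g \<in> fundamental_box zscale B p"
    and eq: "f + zscale p v = g + zscale p w"
  shows "f = g"
proof -
  obtain c where c: "f = combination c" "\<forall>b\<in>B. 0 \<le> c b \<and> c b < p"
    using assms(1) by (auto simp: fundamental_box_def combination_def)
  obtain d where d: "g = combination d" "\<forall>b\<in>B. 0 \<le> d b \<and> d b < p"
    using assms(2) by (auto simp: fundamental_box_def combination_def)
  have "c b = d b" if b: "b \<in> B" for b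
  proof -
    have "c b + p * coordinates v b = d b + p * coordinates w b"
      using arg_cong[OF eq, of "\<lambda>u. coordinates u b"] c d b
      by (simp add: coordinates_add coordinates_scale coordinates_combination)
    then have "c b mod p = d b mod p"
      by (metis mod_mult_self2)
    then show ?thesis using c d b by simp
  qed
  then show ?thesis using c d by (simp add: combination_def)
qed

lemma period_add_iff:
  assumes "is_period zscale A p"
  shows "a + zscale p v \<in> A \<longleftrightarrow> a \<in> A"
proof -
  have A: "a + zscale p v \<in> A" if "a \<in> A" for a v
    using assms that unfolding is_period_def by blast
  show ?thesis using A[of a v] A[of "a + zscale p v" "- v"] by auto
qed

section \<open>Densities of periodic sets\<close>

lemma count_by_residues:
  assumes N: "is_norm N" and A: "is_period zscale A p"
  shows "card {a \<in> A. N (a \<otimes>\<^sub>\<real> 1) < r} =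
    (\<Sum>f \<in> fundamental_box zscale B p \<inter> A. card {w. N (f \<otimes>\<^sub>\<real> 1 + zscale p w \<otimes>\<^sub>\<real> 1) < r})"
proof -
  let ?F = "fundamental_box zscale B p \<inter> A"
  let ?R = "\<lambda>f. {w. N (f \<otimes>\<^sub>\<real> 1 + zscale p w \<otimes>\<^sub>\<real> 1) < r}"
  have p: "0 < p" using A by (simp add: is_period_def)
  have inj: "inj_on (\<lambda>w. f + zscale p w) W" for f W
    by (rule inj_onI, rule zscale_inject[of p]) (use p in auto)
  have eq: "{a \<in> A. N (a \<otimes>\<^sub>\<real> 1) < r} = (\<Union>f\<in>?F. (\<lambda>w. f + zscale p w) ` ?R f)"
  proof (intro subset_antisym subsetI)
    fix a assume a: "a \<in> {a \<in> A. N (a \<otimes>\<^sub>\<real> 1) < r}"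
    obtain f w where fw: "f \<in> fundamental_box zscale B p" "a = f + zscale p w"
      using box_remainder[OF p] by blast
    then show "a \<in> (\<Union>f\<in>?F. (\<lambda>w. f + zscale p w) ` ?R f)"
      using a period_add_iff[OF A, of f w] by (auto simp: tensor_add_left)
  qed (auto simp: period_add_iff[OF A] tensor_add_left)
  have fin: "finite ((\<lambda>w. f + zscale p w) ` ?R f)" for f
    by (rule finite_subset[OF _ finite_norm_ball[OF N, of r]]) (auto simp: tensor_add_left)
  have "card {a \<in> A. N (a \<otimes>\<^sub>\<real> 1) < r} = (\<Sum>f\<in>?F. card ((\<lambda>w. f + zscale p w) ` ?R f))"
    unfolding eq using finite_fundamental_box fin box_remainder_unique
    by (intro card_UN_disjoint) blast+
  then show ?thesis by (simp add: card_image[OF inj])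
qed

text \<open>Each residue class contributes the same number of points asymptotically as the class \<open>p L\<close>, so after
  division by the count of \<open>p L\<close> the numerator tends to the number of classes in \<open>A\<close> and the denominator
  to the number of all classes.\<close>

lemma density_quotient_tendsto:
  assumes N: "is_norm N" and A: "is_period zscale A p"
  shows "(density_quotient N A \<longlongrightarrow>
    real (card (fundamental_box zscale B p \<inter> A)) / real (card (fundamental_box zscale B p))) at_top"
proof -
  let ?F = "fundamental_box zscale B p"
  have p: "0 < p" using A by (simp add: is_period_def)
  interpret lattice_in_normed N "\<lambda>v. zscale p v \<otimes>\<^sub>\<real> 1"
    by (rule lattice_in_real_tensor[OF N p])
  have lim: "((\<lambda>r. real (card {a \<in> S. N (a \<otimes>\<^sub>\<real> 1) < r}) / real (ball_count r)) \<longlongrightarrow> real (card (?F \<inter> S))) at_top"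
    if S: "is_period zscale S p" for S
  proof -
    have "((\<lambda>r. \<Sum>f \<in> ?F \<inter> S. real (card {w. N (f \<otimes>\<^sub>\<real> 1 + zscale p w \<otimes>\<^sub>\<real> 1) < r}) / real (ball_count r))
        \<longlongrightarrow> (\<Sum>f \<in> ?F \<inter> S. 1)) at_top"
      by (intro tendsto_sum shifted_ball_count_ratio)
    then show ?thesis by (simp add: count_by_residues[OF N S] sum_divide_distrib)
  qed
  have "\<exists>a w. v = a + zscale p w" for v
    by (rule exI[of _ v], rule exI[of _ 0]) simp
  then have U: "is_period zscale UNIV p"
    using p by (auto simp: is_period_def)
  obtain f where "f \<in> ?F" using box_remainder[OF p] by blast
  then have "card ?F \<noteq> 0" using finite_fundamental_box by auto
  then have "((\<lambda>r. (real (card {a \<in> A. N (a \<otimes>\<^sub>\<real> 1) < r}) / real (ball_count r)) /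
      (real (card {a \<in> UNIV. N (a \<otimes>\<^sub>\<real> 1) < r}) / real (ball_count r)))
      \<longlongrightarrow> real (card (?F \<inter> A)) / real (card (?F \<inter> UNIV))) at_top"
    by (intro tendsto_divide lim A U) simp
  moreover have "\<forall>\<^sub>F r in at_top. (real (card {a \<in> A. N (a \<otimes>\<^sub>\<real> 1) < r}) / real (ball_count r)) /
      (real (card {a \<in> UNIV. N (a \<otimes>\<^sub>\<real> 1) < r}) / real (ball_count r)) = density_quotient N A r"
    using eventually_gt_at_top[of 0]
  proof eventually_elim
    case (elim r)
    then show ?case using ball_count_pos[of r] by (simp add: density_quotient_def)
  qed
  ultimately show ?thesis by (simp add: tendsto_cong)
qed

lemma density_wrt_eq:
  assumes "is_norm N" "is_period zscale A p"
  shows "density_wrt N A = real (card (fundamental_box zscale B p \<inter> A)) / real (card (fundamental_box zscale B p))"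
  unfolding density_wrt_def
  by (rule tendsto_Lim[OF _ density_quotient_tendsto[OF assms]]) simp

lemma lattice_density_eq:
  assumes A: "is_period zscale A p"
  shows "lattice_density A = real (card (fundamental_box zscale B p \<inter> A)) / real (card (fundamental_box zscale B p))"
  unfolding lattice_density_def
proof (rule the_equality)
  show "\<forall>N. is_norm N \<longrightarrow> density_exists N A \<and> density_wrt N A =
      real (card (fundamental_box zscale B p \<inter> A)) / real (card (fundamental_box zscale B p))"
    using density_quotient_tendsto[OF _ A] density_wrt_eq[OF _ A] unfolding density_exists_def by blast
next
  fix d assume "\<forall>N. is_norm N \<longrightarrow> density_exists N A \<and> density_wrt N A = d"
  then show "d = real (card (fundamental_box zscale B p \<inter> A)) / real (card (fundamental_box zscale B p))"
    using norm_exists density_wrt_eq[OF _ A] by metis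
qed

lemma is_period_translate:
  assumes A: "is_period zscale A p"
  shows "is_period zscale ((\<lambda>a. a + x) ` A) p"
proof -
  have "0 < p" using A by (simp add: is_period_def)
  moreover have "{a + zscale p v | a v. a \<in> (\<lambda>a. a + x) ` A} = (\<lambda>a. a + x) ` {a + zscale p v | a v. a \<in> A}"
    by (force simp: algebra_simps)
  ultimately show ?thesis using A by (simp add: is_period_def)
qed

text \<open>Translation by \<open>x\<close> followed by reduction into the box maps the points of \<open>A\<close> in the box injectively
  to points of \<open>A + x\<close> in the box. Applying this also to \<open>A + x\<close> and \<open>- x\<close> gives equality.\<close>

lemma card_box_translate:
  assumes A: "is_period zscale A p"
  shows "card (fundamental_box zscale B p \<inter> (\<lambda>a. a + x) ` A) = card (fundamental_box zscale B p \<inter> A)"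
proof -
  let ?F = "fundamental_box zscale B p"
  have le: "card (?F \<inter> S) \<le> card (?F \<inter> (\<lambda>a. a + x) ` S)" if S: "is_period zscale S p" for S x
  proof -
    have p: "0 < p" using S by (simp add: is_period_def)
    define f where "f v = (SOME g. g \<in> ?F \<and> (\<exists>w. v + x = g + zscale p w))" for v
    have f: "f v \<in> ?F \<and> (\<exists>w. v + x = f v + zscale p w)" for v
      unfolding f_def by (rule someI_ex) (use box_remainder[OF p, of "v + x"] in blast)
    show ?thesis
    proof (rule card_inj_on_le[of f])
      show "finite (?F \<inter> (\<lambda>a. a + x) ` S)" using finite_fundamental_box by blast
      show "f ` (?F \<inter> S) \<subseteq> ?F \<inter> (\<lambda>a. a + x) ` S"
      proof clarify
        fix v assume v: "v \<in> S"
        obtain w where w: "v + x = f v + zscale p w" using f by blast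
        then have "f v + zscale p w \<in> (\<lambda>a. a + x) ` S" using v by (metis imageI)
        then show "f v \<in> ?F \<inter> (\<lambda>a. a + x) ` S"
          using f period_add_iff[OF is_period_translate[OF S]] by blast
      qed
      show "inj_on f (?F \<inter> S)"
      proof (rule inj_onI)
        fix u v assume uv: "u \<in> ?F \<inter> S" "v \<in> ?F \<inter> S" "f u = f v"
        obtain w where w: "u + x = f u + zscale p w" using f by blast
        obtain w' where w': "v + x = f v + zscale p w'" using f by blast
        have "u + zscale p w' + x = (u + x) + zscale p w'" by (simp add: ac_simps)
        also have "\<dots> = (v + x) + zscale p w" unfolding w w' uv(3) by (simp add: ac_simps)
        also have "\<dots> = v + zscale p w + x" by (simp add: ac_simps)
        finally have "u + zscale p w' = v + zscale p w" by simp
        then show "u = v" using box_remainder_unique uv by blast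
      qed
    qed
  qed
  have "(\<lambda>a. a + - x) ` (\<lambda>a. a + x) ` A = A" by (simp add: image_image)
  then show ?thesis
    using le[OF A, of x] le[OF is_period_translate[OF A, of x], of "- x"] by simp
qed

text \<open>Every coset of \<open>A\<close> meets the box, because \<open>A\<close> contains \<open>p L\<close>, and by the previous lemma all cosets
  share the box equally.\<close>

lemma card_box_subgroup:
  assumes A: "is_period zscale A p" and sub: "subspace A"
  shows "card (fundamental_box zscale B p) = subgroup_index A * card (fundamental_box zscale B p \<inter> A)"
proof -
  let ?F = "fundamental_box zscale B p"
  let ?Q = "{(\<lambda>a. x + a) ` A | x. True}"
  have p: "0 < p" using A by (simp add: is_period_def)
  have coset: "u \<in> (\<lambda>a. x + a) ` A \<longleftrightarrow> u - x \<in> A" for u x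
    by (auto simp: image_iff intro: bexI[of _ "u - x"])
  have mem: "(\<lambda>a. x + a) ` A = (\<lambda>a. y + a) ` A" if "u - x \<in> A" "u - y \<in> A" for u x y
  proof -
    have "x - y \<in> A" using subspace_diff[OF sub that(2,1)] by simp
    then have "v - x \<in> A \<longleftrightarrow> v - y \<in> A" for v
      using subspace_add[OF sub, of "v - x" "x - y"] subspace_diff[OF sub, of "v - y" "x - y"] by auto
    then show ?thesis using coset by blast
  qed
  have "?Q \<subseteq> (\<lambda>x. (\<lambda>a. x + a) ` A) ` ?F"
  proof clarify
    fix x
    obtain f w where f: "f \<in> ?F" "x = f + zscale p w" using box_remainder[OF p] by blast
    then have "x - f \<in> A"
      using period_add_iff[OF A, of 0 w] subspace_0[OF sub] by simp
    then have "(\<lambda>a. x + a) ` A = (\<lambda>a. f + a) ` A"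
      using mem[of x x f] subspace_0[OF sub] by simp
    then show "(\<lambda>a. x + a) ` A \<in> (\<lambda>x. (\<lambda>a. x + a) ` A) ` ?F" using f by blast
  qed
  then have finQ: "finite ?Q" by (rule finite_subset) (simp add: finite_fundamental_box)
  have "?F = (\<Union>C\<in>?Q. ?F \<inter> C)"
  proof (intro subset_antisym subsetI)
    fix f assume "f \<in> ?F"
    moreover have "f \<in> (\<lambda>a. f + a) ` A" using coset subspace_0[OF sub] by simp
    ultimately show "f \<in> (\<Union>C\<in>?Q. ?F \<inter> C)" by blast
  qed blast
  moreover have "card (\<Union>C\<in>?Q. ?F \<inter> C) = (\<Sum>C\<in>?Q. card (?F \<inter> C))"
  proof (rule card_UN_disjoint[OF finQ])
    show "\<forall>C\<in>?Q. \<forall>C'\<in>?Q. C \<noteq> C' \<longrightarrow> ?F \<inter> C \<inter> (?F \<inter> C') = {}"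
    proof (intro ballI impI)
      fix C C' assume C: "C \<in> ?Q" "C' \<in> ?Q" "C \<noteq> C'"
      then obtain x y where xy: "C = (\<lambda>a. x + a) ` A" "C' = (\<lambda>a. y + a) ` A" by blast
      have "False" if "u \<in> C" "u \<in> C'" for u
        using mem[of u x y] coset[of u x] coset[of u y] that C(3) unfolding xy by blast
      then show "?F \<inter> C \<inter> (?F \<inter> C') = {}" by blast
    qed
  qed (use finite_fundamental_box in blast)
  moreover have "card (?F \<inter> C) = card (?F \<inter> A)" if C: "C \<in> ?Q" for C
  proof -
    obtain x where "C = (\<lambda>a. x + a) ` A" using C by blast
    then have "C = (\<lambda>a. a + x) ` A" by (simp add: add.commute)
    then show ?thesis by (simp only: card_box_translate[OF A])
  qed
  ultimately show ?thesis by (simp add: subgroup_index_def)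
qed

lemma lattice_density_subgroup:
  assumes A: "is_period zscale A p" and sub: "subspace A"
  shows "lattice_density A = 1 / real (subgroup_index A)"
proof -
  have "0 < p" using A by (simp add: is_period_def)
  then obtain f where "f \<in> fundamental_box zscale B p" using box_remainder by blast
  then have "card (fundamental_box zscale B p) \<noteq> 0" using finite_fundamental_box by auto
  then show ?thesis
    unfolding lattice_density_eq[OF A] card_box_subgroup[OF A sub] by simp
qed

lemma lattice_density_translate:
  assumes A: "is_period zscale A p"
  shows "lattice_density ((\<lambda>a. a + x) ` A) = lattice_density A"
  by (simp add: lattice_density_eq[OF A] lattice_density_eq[OF is_period_translate[OF A]] card_box_translate[OF A])

end

theorem theorem2p1:
  fixes zscale :: "int \<Rightarrow> 'l::ab_group_add \<Rightarrow> 'l"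
    and n :: nat
    and A :: "'l set"
  assumes "is_free_of_rank zscale n"
    and "is_periodic zscale A"
  shows "(\<forall>N p B. is_norm N \<and> is_period zscale A p \<and> is_basis zscale B \<longrightarrow>
            density_exists N A \<and>
            density_wrt N A =
              real (card (fundamental_box zscale B p \<inter> A)) / real (card (fundamental_box zscale B p)))
       \<and> (\<exists>!d. \<forall>N p B. is_norm N \<and> is_period zscale A p \<and> is_basis zscale B \<longrightarrow>
            density_wrt N A = d \<and>
            real (card (fundamental_box zscale B p \<inter> A)) / real (card (fundamental_box zscale B p)) = d)
       \<and> (\<forall>N. is_norm N \<longrightarrow> density_wrt N A = lattice_density A)
       \<and> (module.subspace zscale A \<longrightarrow> lattice_density A = 1 / real (subgroup_index A))
       \<and> (\<forall>x. lattice_density ((\<lambda>a. a + x) ` A) = lattice_density A)"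
proof -
  have free_int: "free_int_module zscale B" if "is_basis zscale B" for B
    using assms(1) finite_of_is_basis[OF assms(1) that] that
    by (simp add: free_int_module_def free_int_module_axioms_def is_free_of_rank_def)
  obtain B0 where B0: "is_basis zscale B0"
    using assms(1) by (auto simp: is_free_of_rank_def)
  obtain p0 where p0: "is_period zscale A p0"
    using assms(2) by (auto simp: is_periodic_def)
  interpret free_int_module zscale B0 by (rule free_int[OF B0])
  obtain N0 :: "'l real_tensor \<Rightarrow> real" where N0: "is_norm N0"
    using norm_exists by blast
  have box: "real (card (fundamental_box zscale B p \<inter> A)) / real (card (fundamental_box zscale B p)) = lattice_density A"
    if "is_period zscale A p" "is_basis zscale B" for p B
    by (rule free_int_module.lattice_density_eq[OF free_int[OF that(2)] that(1), symmetric])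
  have wrt: "density_exists N A" "density_wrt N A = lattice_density A" if "is_norm N" for N
    using density_quotient_tendsto[OF that p0] density_wrt_eq[OF that p0] lattice_density_eq[OF p0]
    by (auto simp: density_exists_def)
  show ?thesis
  proof (intro conjI ex1I[of _ "lattice_density A"])
    show "\<And>d. \<forall>N p B. is_norm N \<and> is_period zscale A p \<and> is_basis zscale B \<longrightarrow>
            density_wrt N A = d \<and>
            real (card (fundamental_box zscale B p \<inter> A)) / real (card (fundamental_box zscale B p)) = d
          \<Longrightarrow> d = lattice_density A"
      using N0 p0 B0 wrt by metis
  qed (use box wrt lattice_density_subgroup[OF p0] lattice_density_translate[OF p0] in auto)
qed

end
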